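(* Let $1\leq c\leq d$ be integers with $c\equiv i\pmod 5$, $d\equiv j\pmod 5$, $0\le i,j\le 4$, and let $a$ be one of the values $a_{ij}$ listed below (with $a_{ij}:=a_{ji}$ when $i>j$): $(0,0)\!:1,2,3,4$; $(0,1)\!:2,3,4$; $(0,2)\!:1,3,4$; $(0,3)\!:1,2,4$; $(0,4)\!:1,2,3$; $(1,1)\!:3,4$; $(1,2)\!:4$; $(1,3)\!:2$; $(1,4)\!:2,3$; $(2,2)\!:1,3$; $(2,3)\!:1,4$; $(2,4)\!:3$; $(3,3)\!:2,4$; $(3,4)\!:1$; $(4,4)\!:1,2$. Then for every $n\ge 0$ and every $0\le k\le 4$, \[ N_{[c,d]}(k,5,5n+a)=\frac{p_{[c^2d^2]}(5n+a)}{5}, \] and in particular $p_{[c^2d^2]}(5n+a)\equiv 0\pmod 5$.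
   Context: A 4-colored partition of type $(c,d)$ of $n$ is a quadruple $(\pi_r,\pi_b,\pi_y,\pi_o)$ of ordinary partitions with total sum of parts $n$, such that all parts of $\pi_r,\pi_b$ are divisible by $c$ and all parts of $\pi_y,\pi_o$ are divisible by $d$. Their number is $p_{[c^2d^2]}(n)$, i.e. $\sum_n p_{[c^2d^2]}(n)q^n=\prod_{k\ge1}(1-q^{ck})^{-2}(1-q^{dk})^{-2}$. The 4-colored rank is $r_4=\ell(\pi_r)-\ell(\pi_b)+\ell(\pi_y)-\ell(\pi_o)$, where $\ell$ is the number of parts. $N_{[c,d]}(k,5,n)$ denotes the number of 4-colored partitions of $n$ of type $(c,d)$ with $r_4\equiv k\pmod 5$. *)

theory Defs
  imports Complex_Main "HOL-Library.Multiset"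
begin

definition is_partition :: "nat multiset \<Rightarrow> bool" where
  "is_partition \<pi> \<longleftrightarrow> (\<forall>x \<in># \<pi>. 0 < x)"

definition parts_dvd :: "nat \<Rightarrow> nat multiset \<Rightarrow> bool" where
  "parts_dvd c \<pi> \<longleftrightarrow> (\<forall>x \<in># \<pi>. c dvd x)"

definition four_col_parts ::
  "nat \<Rightarrow> nat \<Rightarrow> nat \<Rightarrow> (nat multiset \<times> nat multiset \<times> nat multiset \<times> nat multiset) set" where
  "four_col_parts c d n =
     {(pr, pb, py, po). is_partition pr \<and> is_partition pb \<and> is_partition py \<and> is_partition po \<and>
        parts_dvd c pr \<and> parts_dvd c pb \<and> parts_dvd d py \<and> parts_dvd d po \<and>
        sum_mset pr + sum_mset pb + sum_mset py + sum_mset po = n}"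

definition p4 :: "nat \<Rightarrow> nat \<Rightarrow> nat \<Rightarrow> nat" where
  "p4 c d n = card (four_col_parts c d n)"

definition rank4 :: "nat multiset \<times> nat multiset \<times> nat multiset \<times> nat multiset \<Rightarrow> int" where
  "rank4 q = (case q of (pr, pb, py, po) \<Rightarrow>
      int (size pr) - int (size pb) + int (size py) - int (size po))"

definition N4 :: "nat \<Rightarrow> nat \<Rightarrow> int \<Rightarrow> nat \<Rightarrow> nat \<Rightarrow> nat" where
  "N4 c d k m n = card {q \<in> four_col_parts c d n. rank4 q mod int m = k mod int m}"

definition a_tab :: "nat \<Rightarrow> nat \<Rightarrow> nat set" where
  "a_tab i j =
    (if (i, j) = (0, 0) then {1, 2, 3, 4}
     else if (i, j) = (0, 1) then {2, 3, 4}
     else if (i, j) = (0, 2) then {1, 3, 4}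
     else if (i, j) = (0, 3) then {1, 2, 4}
     else if (i, j) = (0, 4) then {1, 2, 3}
     else if (i, j) = (1, 1) then {3, 4}
     else if (i, j) = (1, 2) then {4}
     else if (i, j) = (1, 3) then {2}
     else if (i, j) = (1, 4) then {2, 3}
     else if (i, j) = (2, 2) then {1, 3}
     else if (i, j) = (2, 3) then {1, 4}
     else if (i, j) = (2, 4) then {3}
     else if (i, j) = (3, 3) then {2, 4}
     else if (i, j) = (3, 4) then {1}
     else if (i, j) = (4, 4) then {1, 2}
     else {})"

definition a_vals :: "nat \<Rightarrow> nat \<Rightarrow> nat set" where
  "a_vals i j = (if i \<le> j then a_tab i j else a_tab j i)"

end

theory Submission
  imports Defs "HOL-Computational_Algebra.Formal_Power_Series"
begin

text \<open>
  Let \<open>\<zeta>\<close> be a primitive fifth root of unity. The rank generating function at \<open>\<zeta>\<close> is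
  \<open>G(q^c) G(q^d)\<close> with \<open>G(q) = 1 / \<Prod>(1 - \<zeta> q^k)(1 - \<zeta>^4 q^k)\<close>. Multiplying numerator and
  denominator by the three missing factors turns the denominator into \<open>\<Prod>(1 - q^(5k))\<close> and the
  numerator into \<open>\<Prod>(1 - q^k)(1 - \<zeta>^2 q^k)(1 - \<zeta>^3 q^k)\<close>, which by the Jacobi triple product is
  \<open>\<Sum> (-1)^j \<chi>_j q^(j(j+1)/2)\<close> with \<open>\<chi>_j = \<zeta>^(-2j) + \<zeta>^(-2j+2) + \<dots> + \<zeta>^(2j)\<close>. As \<open>\<chi>_j = 0\<close> for
  \<open>j \<equiv> 2\<close>, only exponents \<open>0\<close> and \<open>1\<close> modulo 5 survive in \<open>G\<close>, so the exponents in \<open>G(q^c) G(q^d)\<close> lie in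
  \<open>{0, c, d, c + d}\<close> modulo 5; the listed residues are exactly those outside this set. Fourier
  inversion modulo 5 then gives the equidistribution of the rank. Infinite products are avoided
  by working with the parts up to \<open>N\<close> and modulo \<open>q^(N+1)\<close>.
\<close>

unbundle fps_syntax

section \<open>Multisets with parts in a finite set\<close>

definition msets :: "nat set \<Rightarrow> nat \<Rightarrow> nat multiset set" where
  "msets S n = {\<pi>. set_mset \<pi> \<subseteq> S \<and> sum_mset \<pi> = n}"

lemma size_le_sum_mset: "(\<And>x. x \<in># \<pi> \<Longrightarrow> 0 < x) \<Longrightarrow> size \<pi> \<le> sum_mset (\<pi> :: nat multiset)"
proof (induction \<pi>)
  case (add x \<pi>)
  have "0 < x" "size \<pi> \<le> sum_mset \<pi>"
    using add.prems add.IH by auto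
  then show ?case by simp
qed simp

lemma finite_msets:
  assumes "finite S" "0 \<notin> S"
  shows "finite (msets S n)"
proof (rule finite_subset)
  show "msets S n \<subseteq> mset ` {xs. set xs \<subseteq> S \<and> length xs \<le> n}"
  proof
    fix \<pi> assume "\<pi> \<in> msets S n"
    then have \<pi>: "set_mset \<pi> \<subseteq> S" "sum_mset \<pi> = n"
      by (auto simp: msets_def)
    obtain xs where xs: "\<pi> = mset xs" by (metis ex_mset)
    have "size \<pi> \<le> n"
      using size_le_sum_mset[of \<pi>] \<pi> assms(2) by (metis gr0I subsetD)
    then show "\<pi> \<in> mset ` {xs. set xs \<subseteq> S \<and> length xs \<le> n}"
      using \<pi> xs by auto
  qed
  show "finite (mset ` {xs. set xs \<subseteq> S \<and> length xs \<le> n})"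
    using finite_lists_length_le[OF assms(1)] by blast
qed

section \<open>Weighted generating functions of sets with a size statistic\<close>

definition gf :: "'a set \<Rightarrow> ('a \<Rightarrow> nat) \<Rightarrow> ('a \<Rightarrow> 'b::comm_ring_1) \<Rightarrow> 'b fps" where
  "gf A s w = Abs_fps (\<lambda>n. \<Sum>x | x \<in> A \<and> s x = n. w x)"

text \<open>The Cauchy product groups pairs by the size of the first component. The fibres must be
  finite because a sum over an infinite set is 0 by convention, which would falsify the
  coefficients.\<close>

lemma gf_mult:
  assumes "\<And>n. finite {x \<in> A. s x = n}" "\<And>n. finite {y \<in> B. t y = n}"
  shows "gf A s v * gf B t w = gf (A \<times> B) (\<lambda>(x, y). s x + t y) (\<lambda>(x, y). v x * w y)"
proof (rule fps_ext)
  fix n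
  let ?A = "\<lambda>i. {x \<in> A. s x = i}" and ?B = "\<lambda>i. {y \<in> B. t y = i}"
  have "(gf A s v * gf B t w) $ n = (\<Sum>i=0..n. (\<Sum>x\<in>?A i. v x) * (\<Sum>y\<in>?B (n - i). w y))"
    by (simp add: fps_mult_nth gf_def)
  also have "\<dots> = (\<Sum>i=0..n. \<Sum>p\<in>?A i \<times> ?B (n - i). case p of (x, y) \<Rightarrow> v x * w y)"
    by (simp add: sum_product sum.cartesian_product)
  also have "\<dots> = (\<Sum>p\<in>(\<Union>i\<in>{0..n}. ?A i \<times> ?B (n - i)). case p of (x, y) \<Rightarrow> v x * w y)"
    by (rule sum.UNION_disjoint[symmetric]) (auto simp: assms)
  also have "(\<Union>i\<in>{0..n}. ?A i \<times> ?B (n - i)) =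
      {p \<in> A \<times> B. (case p of (x, y) \<Rightarrow> s x + t y) = n}"
    by force
  finally show "(gf A s v * gf B t w) $ n =
      gf (A \<times> B) (\<lambda>(x, y). s x + t y) (\<lambda>(x, y). v x * w y) $ n"
    by (simp add: gf_def)
qed

lemma finite_fibre_Times:
  fixes s :: "'a \<Rightarrow> nat" and t :: "'b \<Rightarrow> nat"
  assumes "\<And>n. finite {x \<in> A. s x = n}" "\<And>n. finite {y \<in> B. t y = n}"
  shows "finite {p \<in> A \<times> B. (case p of (x, y) \<Rightarrow> s x + t y) = n}"
proof (rule finite_subset)
  show "{p \<in> A \<times> B. (case p of (x, y) \<Rightarrow> s x + t y) = n} \<subseteq>
      (\<Union>i\<in>{0..n}. {x \<in> A. s x = i} \<times> {y \<in> B. t y = n - i})"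
    by force
qed (auto simp: assms)

definition mset_gf :: "'b::comm_ring_1 \<Rightarrow> nat set \<Rightarrow> 'b fps" where
  "mset_gf z S = gf {\<pi>. set_mset \<pi> \<subseteq> S} sum_mset (\<lambda>\<pi>. z ^ size \<pi>)"

lemma mset_gf_nth: "mset_gf z S $ n = (\<Sum>\<pi>\<in>msets S n. z ^ size \<pi>)"
  by (simp add: mset_gf_def gf_def msets_def)

text \<open>Split by whether \<open>k\<close> occurs. If it does, removing one copy leaves a
  multiset that may still contain \<open>k\<close>, so \<open>insert k S\<close> reappears on the
  right.\<close>

lemma msets_insert:
  assumes "k \<notin> S"
  shows "msets (insert k S) n =
    msets S n \<union> (if k \<le> n then add_mset k ` msets (insert k S) (n - k) else {})"
proof (intro equalityI subsetI)
  fix \<pi> assume \<pi>: "\<pi> \<in> msets (insert k S) n"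
  show "\<pi> \<in> msets S n \<union> (if k \<le> n then add_mset k ` msets (insert k S) (n - k) else {})"
  proof (cases "k \<in># \<pi>")
    case True
    then obtain \<rho> where "\<pi> = add_mset k \<rho>" by (metis mset_add)
    then show ?thesis using \<pi> by (auto simp: msets_def image_iff)
  qed (use \<pi> in \<open>auto simp: msets_def\<close>)
qed (auto simp: msets_def split: if_splits)

text \<open>Removing one copy of \<open>k\<close> costs a factor \<open>z\<close> and lowers the sum
  by \<open>k\<close>; this coefficient recursion is the geometric series for the part
  \<open>k\<close>, written without division.\<close>

lemma mset_gf_insert:
  assumes "finite S" "0 \<notin> S" "k \<notin> S" "0 < k"
  shows "mset_gf z (insert k S) * (1 - fps_const z * fps_X ^ k) = mset_gf z S"
proof (rule fps_ext)
  fix n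
  let ?W = "mset_gf z (insert k S)"
  have "?W $ n = mset_gf z S $ n + (if k \<le> n then z * ?W $ (n - k) else 0)"
  proof (cases "k \<le> n")
    case True
    have fin: "finite (msets S n)" "finite (msets (insert k S) (n - k))"
      using assms by (auto intro!: finite_msets)
    have disj: "msets S n \<inter> add_mset k ` msets (insert k S) (n - k) = {}"
    proof -
      have "k \<notin># \<pi>" if "\<pi> \<in> msets S n" for \<pi>
        using that assms(3) unfolding msets_def by blast
      then show ?thesis by force
    qed
    have "?W $ n = (\<Sum>\<pi>\<in>msets S n. z ^ size \<pi>) +
        (\<Sum>\<pi>\<in>add_mset k ` msets (insert k S) (n - k). z ^ size \<pi>)"
      unfolding mset_gf_nth msets_insert[OF assms(3), of n] using True fin disj
      by (simp add: sum.union_disjoint)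
    also have "(\<Sum>\<pi>\<in>add_mset k ` msets (insert k S) (n - k). z ^ size \<pi>) = z * ?W $ (n - k)"
      by (subst sum.reindex) (simp_all add: mset_gf_nth sum_distrib_left inj_on_def)
    finally show ?thesis using True by (simp add: mset_gf_nth)
  qed (simp add: mset_gf_nth msets_insert[OF assms(3), of n])
  moreover have "(?W * (1 - fps_const z * fps_X ^ k)) $ n =
      ?W $ n - (if k \<le> n then z * ?W $ (n - k) else 0)"
    by (simp add: right_diff_distrib mult.left_commute[of ?W] fps_X_power_mult_right_nth)
  ultimately show "(?W * (1 - fps_const z * fps_X ^ k)) $ n = mset_gf z S $ n"
    by simp
qed

text \<open>Euler's product, obtained by adjoining one part size at a time. The form "product equal
  to 1" lets later arguments cancel factors without dividing.\<close>

lemma mset_gf_mult_prod: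
  assumes "finite S" "0 \<notin> S"
  shows "mset_gf z S * (\<Prod>k\<in>S. 1 - fps_const z * fps_X ^ k) = 1"
  using assms
proof (induction S)
  case empty
  have "msets {} n = (if n = 0 then {{#}} else {})" for n
    by (auto simp: msets_def)
  then show ?case by (auto intro!: fps_ext simp: mset_gf_nth)
next
  case (insert k S)
  then have "mset_gf z (insert k S) * (1 - fps_const z * fps_X ^ k) = mset_gf z S"
    by (intro mset_gf_insert) auto
  then show ?case using insert by (simp add: mult.assoc[symmetric])
qed

lemma prod_multiples:
  assumes "0 < c"
  shows "prod f ((*) c ` {1..N::nat}) = (\<Prod>k=1..N. f (c * k))"
  using assms by (subst prod.reindex) (auto simp: inj_on_def)

lemma mset_gf_multiples:
  assumes "0 < c"
  shows "mset_gf z ((*) c ` {1..N}) * (\<Prod>k=1..N. 1 - fps_const z * (fps_X ^ c) ^ k) = 1"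
proof -
  have "0 \<notin> (*) c ` {1..N}" using assms by auto
  then show ?thesis
    using mset_gf_mult_prod[of "(*) c ` {1..N}" z]
    unfolding prod_multiples[OF assms] power_mult by simp
qed

section \<open>A finite form of the Jacobi triple product\<close>

text \<open>The q-Pochhammer symbol \<open>(q; q)_n\<close>. The base \<open>q\<close> is itself a
  power series, so that \<open>fps_X ^ c\<close> can be substituted for it.\<close>

definition qpoch :: "'a::field fps \<Rightarrow> nat \<Rightarrow> 'a fps" where
  "qpoch q n = (\<Prod>k=1..n. 1 - q ^ k)"

lemma qpoch_0 [simp]: "qpoch q 0 = 1"
  by (simp add: qpoch_def)

lemma qpoch_Suc: "qpoch q (Suc n) = qpoch q n * (1 - q ^ Suc n)"
  by (simp add: qpoch_def)

lemma qpoch_nth_0: "q $ 0 = 0 \<Longrightarrow> qpoch q n $ 0 = 1"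
  by (induction n) (simp_all add: qpoch_Suc fps_power_zeroth)

lemma qpoch_inverse: "q $ 0 = 0 \<Longrightarrow> qpoch q n * inverse (qpoch q n) = 1"
  using inverse_mult_eq_1'[of "qpoch q n"] by (simp add: qpoch_nth_0)

lemma inverse_qpoch_Suc:
  assumes "q $ 0 = 0"
  shows "inverse (qpoch q n) = inverse (qpoch q (Suc n)) * (1 - q ^ Suc n)"
proof -
  have "inverse (qpoch q n) = inverse (qpoch q n) * (qpoch q (Suc n) * inverse (qpoch q (Suc n)))"
    using qpoch_inverse[OF assms] by simp
  also have "\<dots> = (qpoch q n * inverse (qpoch q n)) * (inverse (qpoch q (Suc n)) * (1 - q ^ Suc n))"
    by (simp add: qpoch_Suc ac_simps)
  finally show ?thesis using qpoch_inverse[OF assms] by simp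
qed

text \<open>The cut-off to \<open>0\<close> makes the relations \<open>invp_Suc_left\<close> and \<open>invp_Suc_right\<close> below valid at
  the boundary, where the factor \<open>1 - q ^ 0\<close> vanishes.\<close>

definition invp :: "'a::field fps \<Rightarrow> nat \<Rightarrow> nat \<Rightarrow> 'a fps" where
  "invp q N j = (if j \<le> N then inverse (qpoch q (N - j)) else 0)"

lemma invp_Suc_left:
  assumes "q $ 0 = 0" "j \<le> Suc N"
  shows "invp q N j = invp q (Suc N) j * (1 - q ^ (Suc N - j))"
proof (cases "j = Suc N")
  case False
  then have "j \<le> N" using assms by simp
  then show ?thesis
    using inverse_qpoch_Suc[OF assms(1), of "N - j"] by (simp add: invp_def Suc_diff_le)
qed (simp add: invp_def)

lemma invp_Suc_right:
  assumes "q $ 0 = 0" "j \<le> N"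
  shows "invp q N (Suc j) = invp q N j * (1 - q ^ (N - j))"
proof (cases "j = N")
  case False
  then obtain m where "N - j = Suc m" "N - Suc j = m" "Suc j \<le> N" using assms
    by (metis Suc_diff_Suc le_neq_implies_less Suc_leI)
  then show ?thesis
    using inverse_qpoch_Suc[OF assms(1), of m] by (simp add: invp_def)
qed (simp add: invp_def)

text \<open>The \<open>q\<close>-binomial coefficient \<open>2N+1\<close> over \<open>N-j\<close>.\<close>

definition qbin :: "'a::field fps \<Rightarrow> nat \<Rightarrow> nat \<Rightarrow> 'a fps" where
  "qbin q N j = qpoch q (2 * N + 1) * invp q N j * inverse (qpoch q (N + 1 + j))"

lemma qbin_eq_0: "N < j \<Longrightarrow> qbin q N j = 0"
  by (simp add: qbin_def invp_def)

text \<open>A two-step q-Pascal rule, the one that comparing coefficients of \<open>chi\<close> in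
  the triple product demands. All terms share the factor \<open>U\<close>; with \<open>a\<close> and
  \<open>b\<close> as below the claim reduces to \<open>(1 - ab)(1 - qab) = (1 + ab)(1 - a)(1 - qb)
  + a(1 - qb)(1 - b) + b(1 - a)(q - a)\<close>.\<close>

lemma qbin_rec_Suc:
  assumes q: "q $ 0 = 0" and j: "j \<le> N"
  shows "qbin q (Suc N) (Suc j) = (1 + q ^ (2 * N + 2)) * qbin q N (Suc j) +
    q ^ (N - j) * qbin q N j + q ^ (N + j + 3) * qbin q N (Suc (Suc j))"
proof -
  define a where "a = q ^ (N - j)"
  define b where "b = q ^ (N + j + 2)"
  define U where "U = qpoch q (2 * N + 1) * invp q (Suc N) (Suc j) * inverse (qpoch q (N + j + 3))"
  have ab: "q ^ (2 * N + 2) = a * b"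
    unfolding a_def b_def power_add[symmetric] using j by (intro arg_cong[of _ _ "\<lambda>n. q ^ n"]) simp
  have i1: "invp q N (Suc j) = invp q (Suc N) (Suc j) * (1 - a)"
    using invp_Suc_left[OF q, of "Suc j" N] j by (simp add: a_def)
  have i2: "invp q N j = invp q (Suc N) (Suc j)"
    by (simp add: invp_def)
  \<comment> \<open>The extra \<open>q\<close> turns \<open>q ^ (N - j - 1)\<close> into
    \<open>a\<close>. For \<open>j = N\<close> both sides vanish, the right one because
    \<open>a = 1\<close>.\<close>
  have i3: "q * invp q N (Suc (Suc j)) = invp q (Suc N) (Suc j) * (1 - a) * (q - a)"
  proof (cases "j = N")
    case False
    then have "q * q ^ (N - Suc j) = a"
      using j by (simp add: a_def power_Suc[symmetric] Suc_diff_Suc del: power_Suc)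
    moreover have "invp q N (Suc (Suc j)) = invp q (Suc N) (Suc j) * (1 - a) * (1 - q ^ (N - Suc j))"
      using invp_Suc_right[OF q, of "Suc j" N] j False i1 by simp
    ultimately show ?thesis by (simp add: right_diff_distrib[of q])
  qed (simp add: invp_def a_def)
  have p1: "inverse (qpoch q (N + 1 + Suc j)) = inverse (qpoch q (N + j + 3)) * (1 - q * b)"
    using inverse_qpoch_Suc[OF q, of "N + j + 2"] by (simp add: b_def numeral_3_eq_3)
  have p2: "inverse (qpoch q (N + 1 + j)) = inverse (qpoch q (N + j + 3)) * (1 - q * b) * (1 - b)"
    using inverse_qpoch_Suc[OF q, of "N + j + 1"] p1 by (simp add: b_def mult.assoc)
  have p3: "qpoch q (2 * Suc N + 1) = qpoch q (2 * N + 1) * (1 - a * b) * (1 - q * (a * b))"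
    using qpoch_Suc[of q "2 * N + 1"] qpoch_Suc[of q "2 * N + 2"] by (simp flip: ab)
  have e0: "qbin q (Suc N) (Suc j) = U * ((1 - a * b) * (1 - q * (a * b)))"
    unfolding qbin_def p3 U_def by (simp add: numeral_3_eq_3 ac_simps)
  have e1: "qbin q N (Suc j) = U * ((1 - a) * (1 - q * b))"
    unfolding qbin_def p1 i1 U_def by (simp only: ac_simps)
  have e2: "qbin q N j = U * ((1 - q * b) * (1 - b))"
    unfolding qbin_def p2 i2 U_def by (simp only: ac_simps)
  have e3: "q * qbin q N (Suc (Suc j)) = U * ((1 - a) * (q - a))"
  proof -
    have "q * qbin q N (Suc (Suc j)) = qpoch q (2 * N + 1) * (q * invp q N (Suc (Suc j))) *
        inverse (qpoch q (N + j + 3))"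
      by (simp add: qbin_def numeral_3_eq_3 ac_simps)
    then show ?thesis unfolding i3 U_def by (simp only: ac_simps)
  qed
  have "q ^ (N + j + 3) * qbin q N (Suc (Suc j)) = b * (q * qbin q N (Suc (Suc j)))"
    by (simp add: b_def numeral_3_eq_3 ac_simps)
  then show ?thesis
    unfolding ab e0 e1 e2 e3 a_def[symmetric] by (simp add: algebra_simps)
qed

text \<open>The preceding recurrence at index -1 in place of \<open>j\<close>: there
  \<open>a\<close> and \<open>b\<close> coincide, and the symmetry \<open>j <-> -1 - j\<close> of
  the q-binomial coefficient replaces index -1 by 0.\<close>

lemma qbin_rec_0:
  assumes q: "q $ 0 = 0"
  shows "qbin q (Suc N) 0 = (1 + q ^ (2 * N + 2)) * qbin q N 0 +
    q ^ (N + 1) * qbin q N 0 + q ^ (N + 2) * qbin q N 1"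
proof -
  define a where "a = q ^ (N + 1)"
  define U where "U = qpoch q (2 * N + 1) * invp q (Suc N) 0 * inverse (qpoch q (N + 2))"
  have aa: "q ^ (2 * N + 2) = a * a"
    unfolding a_def power_add[symmetric] by (intro arg_cong[of _ _ "\<lambda>n. q ^ n"]) simp
  have i1: "invp q N 0 = invp q (Suc N) 0 * (1 - a)"
    using invp_Suc_left[OF q, of 0 N] by (simp add: a_def)
  have i2: "q * invp q N 1 = invp q (Suc N) 0 * (1 - a) * (q - a)"
    using invp_Suc_right[OF q, of 0 N] i1 by (simp add: a_def right_diff_distrib[of q])
  have p1: "inverse (qpoch q (N + 1 + 0)) = inverse (qpoch q (N + 2)) * (1 - q * a)"
    using inverse_qpoch_Suc[OF q, of "N + 1"] by (simp add: a_def)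
  have p3: "qpoch q (2 * Suc N + 1) = qpoch q (2 * N + 1) * (1 - a * a) * (1 - q * (a * a))"
    using qpoch_Suc[of q "2 * N + 1"] qpoch_Suc[of q "2 * N + 2"] by (simp flip: aa)
  have e0: "qbin q (Suc N) 0 = U * ((1 - a * a) * (1 - q * (a * a)))"
    unfolding qbin_def p3 U_def by (simp add: ac_simps)
  have e1: "qbin q N 0 = U * ((1 - a) * (1 - q * a))"
    unfolding qbin_def p1 i1 U_def by (simp only: ac_simps)
  have e2: "q * qbin q N 1 = U * ((1 - a) * (q - a))"
  proof -
    have "q * qbin q N 1 = qpoch q (2 * N + 1) * (q * invp q N 1) * inverse (qpoch q (N + 2))"
      by (simp add: qbin_def ac_simps)
    then show ?thesis unfolding i2 U_def by (simp only: ac_simps)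
  qed
  have "q ^ (N + 2) * qbin q N 1 = a * (q * qbin q N 1)"
    by (simp add: a_def ac_simps)
  then show ?thesis
    unfolding aa e0 e1 e2 a_def[symmetric] by (simp add: algebra_simps)
qed

text \<open>With \<open>w = 1/z\<close> this is the symmetric Laurent polynomial \<open>z^(-j) + \<dots> + z^j\<close>.\<close>

fun chi :: "'a::comm_ring_1 \<Rightarrow> 'a \<Rightarrow> nat \<Rightarrow> 'a" where
  "chi z w 0 = 1"
| "chi z w (Suc j) = chi z w j + z ^ Suc j + w ^ Suc j"

text \<open>Multiplication by \<open>z\<close> and \<open>w\<close> shifts the exponent range
  \<open>-j-1..j+1\<close> up and down by one; the two shifted ranges regroup as
  \<open>-j-2..j+2\<close> and \<open>-j..j\<close>.\<close>

lemma chi_mult: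
  assumes "z * w = 1"
  shows "chi z w (Suc j) * (z + w) = chi z w (Suc (Suc j)) + chi z w j"
proof (induction j)
  case 0
  then show ?case using assms by (simp add: algebra_simps power2_eq_square)
next
  case (Suc j)
  have "z * x * w = x" "w * x * z = x" for x
    using assms by (metis mult.assoc mult.commute mult_1)+
  then have "z ^ Suc (Suc j) * w = z ^ Suc j" "w ^ Suc (Suc j) * z = w ^ Suc j"
    by (simp_all only: power_Suc)
  then have "(z ^ Suc (Suc j) + w ^ Suc (Suc j)) * (z + w) =
      z ^ Suc (Suc (Suc j)) + w ^ Suc (Suc (Suc j)) + z ^ Suc j + w ^ Suc j"
    by (simp only: distrib_left distrib_right) (simp add: ac_simps)
  then show ?case using Suc by (simp add: algebra_simps)
qed

text \<open>The new terms form two blocks of five consecutive powers. Both blocks vanish at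
  primitive fifth roots of unity, which makes \<open>chi\<close> periodic there.\<close>

lemma chi_add_5:
  "chi z w (Suc (Suc (Suc (Suc (Suc n))))) = chi z w n +
    z ^ Suc n * (1 + z + z ^ 2 + z ^ 3 + z ^ 4) + w ^ Suc n * (1 + w + w ^ 2 + w ^ 3 + w ^ 4)"
  by (simp add: algebra_simps power_numeral_reduce)

text \<open>The coefficients \<open>(-1)^j q^(j(j+1)/2)\<close> of the triple product, given by the
  ratio of neighbours because the induction over \<open>N\<close> compares neighbouring
  terms.\<close>

fun sgn_tri :: "'a::comm_ring_1 \<Rightarrow> nat \<Rightarrow> 'a" where
  "sgn_tri q 0 = 1"
| "sgn_tri q (Suc j) = - (q ^ Suc j * sgn_tri q j)"

lemma sgn_tri_eq: "sgn_tri q j = (-1) ^ j * q ^ (\<Sum>{..j})"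
  by (induction j) (simp_all add: power_add ac_simps)

lemma sum_atMost_shift:
  fixes f :: "nat \<Rightarrow> 'a::comm_monoid_add"
  assumes "f (Suc N) = 0"
  shows "(\<Sum>j\<le>N. f j) = f 0 + (\<Sum>j\<le>N. f (Suc j))"
  using sum.atMost_Suc_shift[of f N] assms by simp

text \<open>Expand by \<open>chi_mult\<close> and shift indices; the vanishing of \<open>f\<close>
  beyond \<open>N\<close> removes the boundary terms. The term \<open>- f 0\<close> comes from the
  exceptional rule \<open>chi_0 (z + w) = chi_1 - chi_0\<close>.\<close>

lemma sum_chi_mult:
  assumes "z * w = 1" "f (Suc N) = 0" "f (Suc (Suc N)) = 0"
  shows "(\<Sum>j\<le>N. f j * chi z w j) * (z + w) =
    (f 1 - f 0) * chi z w 0 + (\<Sum>j\<le>N. (f j + f (Suc (Suc j))) * chi z w (Suc j))"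
proof -
  have c0: "chi z w 0 * (z + w) = chi z w 1 - chi z w 0" by simp
  have "(\<Sum>j\<le>N. f j * chi z w j) = f 0 * chi z w 0 + (\<Sum>j\<le>N. f (Suc j) * chi z w (Suc j))"
    using assms(2) by (intro sum_atMost_shift) simp
  then have "(\<Sum>j\<le>N. f j * chi z w j) * (z + w) = f 0 * (chi z w 0 * (z + w)) +
      (\<Sum>j\<le>N. f (Suc j) * (chi z w (Suc j) * (z + w)))"
    by (simp only: distrib_right[of _ _ "z + w"] sum_distrib_right mult.assoc)
  also have "\<dots> = f 0 * (chi z w 1 - chi z w 0) +
      (\<Sum>j\<le>N. f (Suc j) * chi z w (Suc (Suc j))) + (\<Sum>j\<le>N. f (Suc j) * chi z w j)"
    unfolding c0 chi_mult[OF assms(1)] by (simp only: distrib_left sum.distrib add.assoc)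
  also have "(\<Sum>j\<le>N. f (Suc j) * chi z w (Suc (Suc j))) =
      (\<Sum>j\<le>N. f j * chi z w (Suc j)) - f 0 * chi z w 1"
    using sum.atMost_Suc_shift[of "\<lambda>j. f j * chi z w (Suc j)" N] assms(2) by simp
  also have "(\<Sum>j\<le>N. f (Suc j) * chi z w j) =
      f 1 * chi z w 0 + (\<Sum>j\<le>N. f (Suc (Suc j)) * chi z w (Suc j))"
    using assms(3) sum_atMost_shift[of "\<lambda>j. f (Suc j) * chi z w j" N] by simp
  finally show ?thesis by (simp add: algebra_simps sum.distrib del: chi.simps)
qed

text \<open>The factor \<open>1 - z\<close> missing from the usual triple product is what turns
  single powers of \<open>z\<close> into \<open>chi\<close>. In the induction the new pair of
  factors equals \<open>1 + q^(2N+2) - q^(N+1) (z + w)\<close>, and each coefficient of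
  \<open>chi\<close> then matches a recurrence for \<open>qbin\<close>.\<close>

theorem finite_triple_product:
  fixes q z w :: "'a::field fps"
  assumes q: "q $ 0 = 0" and zw: "z * w = 1"
  shows "(\<Prod>k=1..N. (1 - z * q ^ k) * (1 - w * q ^ k)) =
    (\<Sum>j\<le>N. sgn_tri q j * qbin q N j * chi z w j)"
proof (induction N)
  case 0
  show ?case using qpoch_inverse[OF q, of 1] by (simp add: qbin_def invp_def)
next
  case (Suc N)
  let ?n = "Suc N"
  let ?f = "\<lambda>j. sgn_tri q j * qbin q N j"
  let ?g = "\<lambda>j. sgn_tri q j * qbin q (Suc N) j"
  have f0: "?f ?n = 0" "?f (Suc ?n) = 0" by (simp_all add: qbin_eq_0)
  have split: "(\<Sum>j\<le>N. ?f j * chi z w j) =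
      ?f 0 * chi z w 0 + (\<Sum>j\<le>N. ?f (Suc j) * chi z w (Suc j))"
    by (rule sum_atMost_shift) (simp add: qbin_eq_0)
  have "(1 - z * q ^ ?n) * (1 - w * q ^ ?n) = 1 + (z * w) * (q ^ ?n * q ^ ?n) - q ^ ?n * (z + w)"
    by (simp only: algebra_simps mult_1)
  also have "\<dots> = (1 + q ^ (2 * N + 2)) - q ^ ?n * (z + w)"
    unfolding zw power_add[symmetric] by (simp add: mult_2)
  finally have step: "(1 - z * q ^ ?n) * (1 - w * q ^ ?n) = (1 + q ^ (2 * N + 2)) - q ^ ?n * (z + w)" .
  have "(\<Prod>k=1..?n. (1 - z * q ^ k) * (1 - w * q ^ k)) =
      (\<Sum>j\<le>N. ?f j * chi z w j) * ((1 - z * q ^ ?n) * (1 - w * q ^ ?n))"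
    using Suc.IH by simp
  also have "\<dots> = (1 + q ^ (2 * N + 2)) * (\<Sum>j\<le>N. ?f j * chi z w j) -
      q ^ ?n * ((\<Sum>j\<le>N. ?f j * chi z w j) * (z + w))"
    unfolding step by (simp only: right_diff_distrib ac_simps)
  also note split
  also have "(?f 0 * chi z w 0 + (\<Sum>j\<le>N. ?f (Suc j) * chi z w (Suc j))) * (z + w) =
      (?f 1 - ?f 0) * chi z w 0 + (\<Sum>j\<le>N. (?f j + ?f (Suc (Suc j))) * chi z w (Suc j))"
    using sum_chi_mult[OF zw, of ?f N, OF f0] by (simp only: split)
  also have "(1 + q ^ (2 * N + 2)) * (?f 0 * chi z w 0 + (\<Sum>j\<le>N. ?f (Suc j) * chi z w (Suc j))) -
      q ^ ?n * ((?f 1 - ?f 0) * chi z w 0 + (\<Sum>j\<le>N. (?f j + ?f (Suc (Suc j))) * chi z w (Suc j))) =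
      ((1 + q ^ (2 * N + 2)) * ?f 0 - q ^ ?n * (?f 1 - ?f 0)) * chi z w 0 +
      (\<Sum>j\<le>N. ((1 + q ^ (2 * N + 2)) * ?f (Suc j) - q ^ ?n * (?f j + ?f (Suc (Suc j)))) * chi z w (Suc j))"
    by (simp only: distrib_left right_diff_distrib left_diff_distrib sum_subtractf sum_distrib_left
        mult.assoc) (simp only: algebra_simps)
  also have "(1 + q ^ (2 * N + 2)) * ?f 0 - q ^ ?n * (?f 1 - ?f 0) = ?g 0"
    unfolding qbin_rec_0[OF q] by (simp add: algebra_simps)
  also have "(\<Sum>j\<le>N. ((1 + q ^ (2 * N + 2)) * ?f (Suc j) - q ^ ?n * (?f j + ?f (Suc (Suc j))))
      * chi z w (Suc j)) = (\<Sum>j\<le>N. ?g (Suc j) * chi z w (Suc j))"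
  proof (rule sum.cong[OF refl])
    fix j assume "j \<in> {..N}"
    then have j: "j \<le> N" by simp
    \<comment> \<open>Splitting powers of \<open>q\<close> rewrites the signs of both neighbours
      \<open>j\<close> and \<open>j + 2\<close> through \<open>sgn_tri q (Suc j)\<close>, so that
      this becomes a common factor.\<close>
    have "q ^ ?n = q ^ Suc j * q ^ (N - j)"
      unfolding power_add[symmetric] using j by simp
    then have 1: "q ^ ?n * ?f j = - (sgn_tri q (Suc j) * (q ^ (N - j) * qbin q N j))"
      by (simp only: sgn_tri.simps(2)[of q j]) (simp only: ac_simps mult_minus_left mult_minus_right minus_minus)
    have "q ^ (N + j + 3) = q ^ ?n * q ^ Suc (Suc j)"
      unfolding power_add[symmetric] by (simp add: numeral_3_eq_3)
    then have 2: "q ^ ?n * ?f (Suc (Suc j)) =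
        - (sgn_tri q (Suc j) * (q ^ (N + j + 3) * qbin q N (Suc (Suc j))))"
      by (simp only: sgn_tri.simps(2)[of q "Suc j"]) (simp only: ac_simps mult_minus_left mult_minus_right)
    show "((1 + q ^ (2 * N + 2)) * ?f (Suc j) - q ^ ?n * (?f j + ?f (Suc (Suc j)))) * chi z w (Suc j) =
        ?g (Suc j) * chi z w (Suc j)"
      unfolding qbin_rec_Suc[OF q j] distrib_left[of "q ^ ?n"] 1 2
      by (simp add: algebra_simps del: sgn_tri.simps chi.simps power_Suc)
  qed
  also have "?g 0 * chi z w 0 + (\<Sum>j\<le>N. ?g (Suc j) * chi z w (Suc j)) = (\<Sum>j\<le>?n. ?g j * chi z w j)"
    by (rule sum.atMost_Suc_shift[symmetric])
  finally show ?case .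
qed


section \<open>The triple product modulo \<open>q ^ (N + 1)\<close>\<close>

lemma qpoch_mod:
  assumes "m \<le> n"
  shows "\<exists>s. qpoch q n = qpoch q m * (1 + q ^ Suc m * s)"
  using assms
proof (induction n rule: dec_induct)
  case base
  show ?case by (rule exI[of _ 0]) simp
next
  case (step n)
  then obtain s where s: "qpoch q n = qpoch q m * (1 + q ^ Suc m * s)" by blast
  have "q ^ Suc n = q ^ Suc m * q ^ (n - m)"
    using step by (simp flip: power_add)
  then have "qpoch q (Suc n) = qpoch q m * (1 + q ^ Suc m * (s - q ^ (n - m) * (1 + q ^ Suc m * s)))"
    unfolding qpoch_Suc s by (simp only: algebra_simps mult_1_right mult_1_left)
  then show ?case by blast
qed

text \<open>The quotients \<open>(q)_N / (q)_(N-j)\<close> and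
  \<open>(q)_(2N+1) / (q)_(N+1+j)\<close> contain only factors \<open>1 - q^k\<close> with
  \<open>k > N - j\<close>.\<close>

lemma qpoch_mult_qbin:
  assumes q: "q $ 0 = 0" and j: "j \<le> N"
  shows "\<exists>s. qpoch q N * qbin q N j = 1 + q ^ Suc (N - j) * s"
proof -
  obtain s where s: "qpoch q N = qpoch q (N - j) * (1 + q ^ Suc (N - j) * s)"
    using qpoch_mod[of "N - j" N q] by auto
  obtain t where t: "qpoch q (2 * N + 1) = qpoch q (N + 1 + j) * (1 + q ^ Suc (N + 1 + j) * t)"
    using qpoch_mod[of "N + 1 + j" "2 * N + 1" q] j by auto
  have e: "q ^ Suc (N + 1 + j) = q ^ Suc (N - j) * q ^ (2 * j + 1)"
    unfolding power_add[symmetric] using j by (intro arg_cong[of _ _ "\<lambda>n. q ^ n"]) simp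
  have "qpoch q N * qbin q N j =
      (qpoch q (N - j) * inverse (qpoch q (N - j))) * (qpoch q (N + 1 + j) * inverse (qpoch q (N + 1 + j))) *
      ((1 + q ^ Suc (N - j) * s) * (1 + q ^ Suc (N + 1 + j) * t))"
    using j by (simp only: qbin_def invp_def s t if_True) (simp only: ac_simps)
  also have "\<dots> = (1 + q ^ Suc (N - j) * s) * (1 + q ^ Suc (N - j) * (q ^ (2 * j + 1) * t))"
    unfolding qpoch_inverse[OF q] e by (simp only: mult_1 mult.assoc)
  also have "\<dots> = 1 + q ^ Suc (N - j) *
      (s + q ^ (2 * j + 1) * t + s * (q ^ Suc (N - j) * (q ^ (2 * j + 1) * t)))"
    by (simp only: algebra_simps mult_1 mult_1_right)
  finally show ?thesis by blast
qed

text \<open>The error of order \<open>N - j + 1\<close> in the \<open>j\<close>-th term is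
  multiplied by \<open>q^(j(j+1)/2)\<close>. Since \<open>j(j+1)/2\<close> is at least
  \<open>j\<close>, the total order is at least \<open>N + 1\<close>.\<close>

theorem triple_product_mod:
  fixes q z w :: "'a::field fps"
  assumes q: "q $ 0 = 0" and zw: "z * w = 1"
  shows "\<exists>s. qpoch q N * (\<Prod>k=1..N. (1 - z * q ^ k) * (1 - w * q ^ k)) =
    (\<Sum>j\<le>N. sgn_tri q j * chi z w j) + q ^ Suc N * s"
proof -
  have "\<forall>j\<in>{..N}. \<exists>s. qpoch q N * (sgn_tri q j * qbin q N j * chi z w j) =
      sgn_tri q j * chi z w j + q ^ Suc N * s"
  proof
    fix j assume "j \<in> {..N}"
    then have j: "j \<le> N" by simp
    then obtain s where s: "qpoch q N * qbin q N j = 1 + q ^ Suc (N - j) * s"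
      using qpoch_mult_qbin[OF q] by blast
    have "j \<le> \<Sum>{..j}" by (cases j) auto
    then have "\<Sum>{..j} + Suc (N - j) = Suc N + (\<Sum>{..j} - j)"
      using j by simp
    then have e: "q ^ (\<Sum>{..j}) * q ^ Suc (N - j) = q ^ Suc N * q ^ (\<Sum>{..j} - j)"
      unfolding power_add[symmetric] by (rule arg_cong)
    have "qpoch q N * (sgn_tri q j * qbin q N j * chi z w j) =
        sgn_tri q j * chi z w j * (qpoch q N * qbin q N j)"
      by (simp only: ac_simps)
    also have "\<dots> = sgn_tri q j * chi z w j +
        (q ^ (\<Sum>{..j}) * q ^ Suc (N - j)) * ((-1) ^ j * chi z w j * s)"
      unfolding s distrib_left by (simp only: sgn_tri_eq ac_simps mult_1)
    also have "\<dots> = sgn_tri q j * chi z w j +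
        q ^ Suc N * (q ^ (\<Sum>{..j} - j) * ((-1) ^ j * chi z w j * s))"
      unfolding e by (simp only: mult.assoc)
    finally show "\<exists>s. qpoch q N * (sgn_tri q j * qbin q N j * chi z w j) =
        sgn_tri q j * chi z w j + q ^ Suc N * s" by blast
  qed
  then obtain s where "\<forall>j\<in>{..N}. qpoch q N * (sgn_tri q j * qbin q N j * chi z w j) =
      sgn_tri q j * chi z w j + q ^ Suc N * s j"
    by metis
  then have "qpoch q N * (\<Prod>k=1..N. (1 - z * q ^ k) * (1 - w * q ^ k)) =
      (\<Sum>j\<le>N. sgn_tri q j * chi z w j + q ^ Suc N * s j)"
    unfolding finite_triple_product[OF q zw] sum_distrib_left by (intro sum.cong) auto
  also have "\<dots> = (\<Sum>j\<le>N. sgn_tri q j * chi z w j) + q ^ Suc N * (\<Sum>j\<le>N. s j)"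
    by (simp only: sum.distrib sum_distrib_left)
  finally show ?thesis by blast
qed

section \<open>Supports modulo 5\<close>

text \<open>The bound \<open>M\<close> reflects the truncation: coefficients of higher degree are
  not controlled.\<close>

definition supp5 :: "nat \<Rightarrow> nat set \<Rightarrow> 'a::zero fps \<Rightarrow> bool" where
  "supp5 M R f \<longleftrightarrow> (\<forall>n\<le>M. f $ n \<noteq> 0 \<longrightarrow> n mod 5 \<in> R)"

lemma supp5_mult:
  fixes f g :: "'a::comm_ring_1 fps"
  assumes "supp5 M R f" "supp5 M T g"
  shows "supp5 M {(r + t) mod 5 | r t. r \<in> R \<and> t \<in> T} (f * g)"
  unfolding supp5_def
proof (intro allI impI)
  fix n assume n: "n \<le> M" "(f * g) $ n \<noteq> 0"
  then obtain i where i: "i \<le> n" "f $ i * g $ (n - i) \<noteq> 0"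
    unfolding fps_mult_nth by (metis (no_types, lifting) atLeastAtMost_iff sum.neutral)
  then have "f $ i \<noteq> 0" "g $ (n - i) \<noteq> 0" by auto
  then have "i mod 5 \<in> R" "(n - i) mod 5 \<in> T"
    using assms i n by (auto simp: supp5_def)
  moreover have "n mod 5 = (i mod 5 + (n - i) mod 5) mod 5"
    using i by (metis le_add_diff_inverse mod_add_eq)
  ultimately show "n mod 5 \<in> {(r + t) mod 5 | r t. r \<in> R \<and> t \<in> T}" by blast
qed

text \<open>Triangular numbers modulo 5 run periodically through 0, 1, 3, 1, 0; the value 3 occurs
  only at the excluded residue.\<close>

lemma triangular_mod5:
  assumes "j mod 5 \<noteq> 2"
  shows "\<Sum>{..j} mod 5 \<in> {0, 1 :: nat}"
proof -
  have shift: "\<Sum>{..5 * m + r} mod 5 = \<Sum>{..r} mod (5::nat)" for m r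
  proof (induction m)
    case (Suc m)
    have "5 * Suc m + r = Suc (Suc (Suc (Suc (Suc (5 * m + r)))))" by simp
    then have "\<Sum>{..5 * Suc m + r} = \<Sum>{..5 * m + r} + 5 * (5 * m + r + 3)"
      by (simp only: sum.atMost_Suc) simp
    then show ?case using Suc by (simp only: mod_mult_self2)
  qed simp
  have "j mod 5 = 0 \<or> j mod 5 = 1 \<or> j mod 5 = 3 \<or> j mod 5 = 4"
    using assms by linarith
  moreover have "\<Sum>{..3::nat} = 6" "\<Sum>{..4::nat} = 10"
    by (simp_all add: eval_nat_numeral)
  ultimately have "\<Sum>{..j mod 5} mod (5::nat) \<in> {0, 1}"
    by (elim disjE) simp_all
  then show ?thesis
    using shift[of "j div 5" "j mod 5"] by simp
qed

section \<open>Roots of the fifth cyclotomic polynomial\<close>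

locale fifth_root =
  fixes \<zeta> :: "'a::field"
  assumes cyclotomic: "1 + \<zeta> + \<zeta> ^ 2 + \<zeta> ^ 3 + \<zeta> ^ 4 = 0"
begin

lemma power_5: "\<zeta> ^ 5 = 1"
proof -
  have "\<zeta> ^ 5 - 1 = (\<zeta> - 1) * (1 + \<zeta> + \<zeta> ^ 2 + \<zeta> ^ 3 + \<zeta> ^ 4)"
    by (simp add: algebra_simps power_numeral_reduce)
  then show ?thesis using cyclotomic by simp
qed

lemma power_mod_5: "\<zeta> ^ n = \<zeta> ^ (n mod 5)"
proof -
  have "\<zeta> ^ n = \<zeta> ^ (5 * (n div 5) + n mod 5)" by simp
  also have "\<dots> = \<zeta> ^ (n mod 5)"
    unfolding power_add power_mult power_5 by simp
  finally show ?thesis .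
qed

text \<open>Pairing inverse roots gives quadratics \<open>1 - a y + y^2\<close> and
  \<open>1 - b y + y^2\<close>, where \<open>a\<close> and \<open>b\<close> are the Gaussian periods
  for 5, with sum -1 and product -1.\<close>

lemma prod_factors:
  "(1 - y) * (1 - fps_const \<zeta> * y) * (1 - fps_const (\<zeta> ^ 2) * y) *
    (1 - fps_const (\<zeta> ^ 3) * y) * (1 - fps_const (\<zeta> ^ 4) * y) = 1 - y ^ 5"
proof -
  define a where "a = fps_const (\<zeta> + \<zeta> ^ 4)"
  define b where "b = fps_const (\<zeta> ^ 2 + \<zeta> ^ 3)"
  have "\<zeta> * \<zeta> ^ 4 = 1" "\<zeta> ^ 2 * \<zeta> ^ 3 = 1"
    using power_5 by (simp_all add: power_numeral_reduce mult.assoc)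
  then have 1: "(1 - fps_const \<zeta> * y) * (1 - fps_const (\<zeta> ^ 4) * y) = 1 - a * y + y ^ 2"
    and 2: "(1 - fps_const (\<zeta> ^ 2) * y) * (1 - fps_const (\<zeta> ^ 3) * y) = 1 - b * y + y ^ 2"
    by (simp_all add: a_def b_def algebra_simps power2_eq_square fps_const_add[symmetric]
        fps_const_mult[symmetric] del: fps_const_add fps_const_mult)
      (metis (no_types, opaque_lifting) fps_const_1_eq_1 fps_const_mult mult.assoc mult.left_commute mult_1)+
  have "\<zeta> + \<zeta> ^ 4 + (\<zeta> ^ 2 + \<zeta> ^ 3) = -1"
    using cyclotomic by (simp add: algebra_simps eq_neg_iff_add_eq_0)
  then have ab: "a + b = -1" by (simp add: a_def b_def fps_const_neg[symmetric] del: fps_const_neg)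
  have "(\<zeta> + \<zeta> ^ 4) * (\<zeta> ^ 2 + \<zeta> ^ 3) = \<zeta> ^ 3 + \<zeta> ^ 4 + \<zeta> ^ 6 + \<zeta> ^ 7"
    by (simp add: algebra_simps power_numeral_reduce)
  also have "\<dots> = -1"
    using cyclotomic power_mod_5[of 6] power_mod_5[of 7] by (simp add: algebra_simps eq_neg_iff_add_eq_0)
  finally have ab': "a * b = -1" by (simp add: a_def b_def fps_const_neg[symmetric] del: fps_const_neg)
  have "(1 - y) * (1 - fps_const \<zeta> * y) * (1 - fps_const (\<zeta> ^ 2) * y) *
      (1 - fps_const (\<zeta> ^ 3) * y) * (1 - fps_const (\<zeta> ^ 4) * y) =
      (1 - y) * ((1 - a * y + y ^ 2) * (1 - b * y + y ^ 2))"
    unfolding 1[symmetric] 2[symmetric] by (simp only: ac_simps)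
  also have "(1 - a * y + y ^ 2) * (1 - b * y + y ^ 2) =
      1 - (a + b) * y + (2 + a * b) * y ^ 2 - (a + b) * y ^ 3 + y ^ 4"
    by (simp add: algebra_simps power_numeral_reduce)
  also have "(1 - y) * \<dots> = 1 - y ^ 5"
    unfolding ab ab' by (simp add: algebra_simps power_numeral_reduce)
  finally show ?thesis .
qed

text \<open>There are \<open>2j + 1\<close> consecutive powers of \<open>\<zeta> ^ 2\<close>; for
  these \<open>j\<close> their number is divisible by 5, so they fill complete residue systems of
  exponents.\<close>

lemma chi_eq_0:
  assumes "j mod 5 = 2"
  shows "chi (\<zeta> ^ 2) (\<zeta> ^ 3) j = 0"
proof -
  let ?z = "\<zeta> ^ 2" and ?w = "\<zeta> ^ 3"
  have z: "1 + ?z + ?z ^ 2 + ?z ^ 3 + ?z ^ 4 = 0"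
    using cyclotomic power_mod_5[of 6] power_mod_5[of 8] by (simp add: algebra_simps flip: power_mult)
  have w: "1 + ?w + ?w ^ 2 + ?w ^ 3 + ?w ^ 4 = 0"
    using cyclotomic power_mod_5[of 6] power_mod_5[of 9] power_mod_5[of 12]
    by (simp add: ac_simps power2_eq_square flip: power_mult)
  have "chi ?z ?w (5 * m + 2) = 0" for m
  proof (induction m)
    case 0
    have "chi ?z ?w 2 = 1 + ?z + ?w + ?z ^ 2 + ?w ^ 2"
      by (simp add: numeral_2_eq_2)
    then show ?case
      using cyclotomic power_mod_5[of 6] by (simp add: algebra_simps flip: power_mult)
  next
    case (Suc m)
    let ?n = "5 * m + 2"
    have "5 * Suc m + 2 = Suc (Suc (Suc (Suc (Suc ?n))))" by simp
    then have "chi ?z ?w (5 * Suc m + 2) = chi ?z ?w ?n +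
        ?z ^ Suc ?n * (1 + ?z + ?z ^ 2 + ?z ^ 3 + ?z ^ 4) +
        ?w ^ Suc ?n * (1 + ?w + ?w ^ 2 + ?w ^ 3 + ?w ^ 4)"
      by (simp only: chi_add_5)
    then show ?case using Suc z w by simp
  qed
  then show ?thesis using assms by (metis mult_div_mod_eq)
qed

text \<open>Up to the error term, the exponents are \<open>c\<close> times triangular numbers.
  \<open>chi_eq_0\<close> removes the indices congruent to 2, and the remaining triangular numbers
  are 0 or 1 modulo 5.\<close>

lemma supp5_theta:
  fixes c N
  defines "q \<equiv> (fps_X :: 'a fps) ^ c"
  assumes c: "0 < c"
  shows "supp5 N {0, c mod 5} (qpoch q N *
    (\<Prod>k=1..N. (1 - fps_const (\<zeta> ^ 2) * q ^ k) * (1 - fps_const (\<zeta> ^ 3) * q ^ k)))"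
  unfolding supp5_def
proof (intro allI impI)
  fix n
  let ?F = "qpoch q N * (\<Prod>k=1..N. (1 - fps_const (\<zeta> ^ 2) * q ^ k) * (1 - fps_const (\<zeta> ^ 3) * q ^ k))"
  assume n: "n \<le> N" and nz: "?F $ n \<noteq> 0"
  have q: "q $ 0 = 0" using c by (simp add: q_def)
  have zw: "fps_const (\<zeta> ^ 2) * fps_const (\<zeta> ^ 3) = 1"
    using power_5 by (simp flip: power_add)
  have chi_const: "chi (fps_const x) (fps_const y) j = fps_const (chi x y j)" for x y :: 'a and j
    by (induction j) (simp_all add: fps_const_power)
  have sgn: "sgn_tri q j = fps_const ((-1) ^ j) * fps_X ^ (c * \<Sum>{..j})" for j
    unfolding sgn_tri_eq q_def power_mult[symmetric] 
    by (simp flip: fps_const_power fps_const_neg)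
  obtain s where s: "?F = (\<Sum>j\<le>N. sgn_tri q j * chi (fps_const (\<zeta> ^ 2)) (fps_const (\<zeta> ^ 3)) j) + q ^ Suc N * s"
    using triple_product_mod[OF q zw] by blast
  \<comment> \<open>The error term is divisible by \<open>fps_X ^ (c * (N + 1))\<close>, hence
    invisible in degrees up to \<open>N\<close>.\<close>
  have "N < c * Suc N" using c by (metis le_imp_less_Suc mult_le_mono1 nat_mult_1 less_eq_Suc_le One_nat_def)
  then have "(q ^ Suc N * s) $ n = 0"
    using n unfolding q_def power_mult[symmetric] by (simp only: fps_X_power_mult_nth) simp
  then have "?F $ n = (\<Sum>j\<le>N. (-1) ^ j * chi (\<zeta> ^ 2) (\<zeta> ^ 3) j * (if n = c * \<Sum>{..j} then 1 else 0))"
    unfolding s sgn chi_const by (simp add: fps_sum_nth mult.assoc fps_X_power_mult_nth ac_simps)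
  then obtain j where j: "chi (\<zeta> ^ 2) (\<zeta> ^ 3) j \<noteq> 0" "n = c * \<Sum>{..j}"
    using nz by (fastforce elim!: sum.not_neutral_contains_not_neutral split: if_splits)
  then have "\<Sum>{..j} mod 5 \<in> {0, 1 :: nat}"
    using chi_eq_0 triangular_mod5 by blast
  moreover have "n mod 5 = c * (\<Sum>{..j} mod 5) mod 5"
    unfolding j by (simp add: mod_mult_right_eq)
  ultimately show "n mod 5 \<in> {0, c mod 5}" by auto
qed

text \<open>The pair equals \<open>?V * ?F\<close> exactly: \<open>?V\<close> inverts the product of
  the \<open>1 - q^(5k)\<close> and has only exponents divisible by 5, so the support comes from the
  theta factor \<open>?F\<close>.\<close>

lemma supp5_pair:
  fixes c N
  defines "S \<equiv> (*) c ` {1..N}"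
  assumes c: "0 < c"
  shows "supp5 N {0, c mod 5} (mset_gf \<zeta> S * mset_gf (\<zeta> ^ 4) S)"
proof -
  let ?q = "fps_X ^ c :: 'a fps"
  let ?A = "\<lambda>i. \<Prod>k=1..N. 1 - fps_const (\<zeta> ^ i) * ?q ^ k"
  let ?F = "qpoch ?q N * (\<Prod>k=1..N. (1 - fps_const (\<zeta> ^ 2) * ?q ^ k) * (1 - fps_const (\<zeta> ^ 3) * ?q ^ k))"
  let ?V = "mset_gf (1 :: 'a) ((*) (5 * c) ` {1..N})"
  have W1: "mset_gf \<zeta> S * ?A 1 = 1" and W4: "mset_gf (\<zeta> ^ 4) S * ?A 4 = 1"
    using mset_gf_multiples[OF c] by (simp_all add: S_def)
  have "?F * ?A 1 * ?A 4 = (\<Prod>k=1..N. 1 - (?q ^ k) ^ 5)"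
    unfolding qpoch_def prod.distrib[symmetric] prod_factors[symmetric]
    by (intro prod.cong refl) (simp only: power_one_right ac_simps)
  also have "\<dots> = (\<Prod>k=1..N. 1 - fps_const 1 * (fps_X ^ (5 * c)) ^ k)"
    by (simp add: power_mult[symmetric] ac_simps)
  finally have V: "?V * (?F * ?A 1 * ?A 4) = 1"
    using mset_gf_multiples[of "5 * c" "1 :: 'a" N] c by simp
  \<comment> \<open>Multiplying by this expression for 1 replaces division by \<open>?A 1\<close>
    and \<open>?A 4\<close>.\<close>
  have "mset_gf \<zeta> S * mset_gf (\<zeta> ^ 4) S =
      mset_gf \<zeta> S * mset_gf (\<zeta> ^ 4) S * (?V * (?F * ?A 1 * ?A 4))"
    unfolding V by simp
  also have "\<dots> = (mset_gf \<zeta> S * ?A 1) * (mset_gf (\<zeta> ^ 4) S * ?A 4) * (?V * ?F)"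
    by (simp only: ac_simps)
  finally have eq: "mset_gf \<zeta> S * mset_gf (\<zeta> ^ 4) S = ?V * ?F"
    unfolding W1 W4 by simp
  have "5 dvd sum_mset \<pi>" if "set_mset \<pi> \<subseteq> (*) (5 * c) ` {1..N}" for \<pi>
    using that by (induction \<pi>) auto
  then have "msets ((*) (5 * c) ` {1..N}) n = {}" if "n mod 5 \<noteq> 0" for n
    using that by (auto simp: msets_def)
  then have "supp5 N {0} ?V"
    unfolding supp5_def mset_gf_nth by (metis singletonI sum.empty)
  from supp5_mult[OF this supp5_theta[OF c]]
  have "supp5 N {(r + t) mod 5 | r t. r \<in> {0} \<and> t \<in> {0, c mod 5}} (?V * ?F)" .
  moreover have "{(r + t) mod 5 | r t. r \<in> {0} \<and> t \<in> {0, c mod 5}} = {0, c mod 5}"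
    by (auto intro: exI[of _ 0] exI[of _ "c mod 5"])
  ultimately show ?thesis unfolding eq by simp
qed

end

section \<open>Four-colored partitions\<close>

text \<open>A nonnegative representative of the rank modulo 5.\<close>

definition wt4 :: "nat multiset \<times> nat multiset \<times> nat multiset \<times> nat multiset \<Rightarrow> nat" where
  "wt4 = (\<lambda>(pr, pb, py, po). size pr + (4 * size pb + (size py + 4 * size po)))"

lemma rank4_mod_5: "rank4 q mod 5 = int (wt4 q) mod 5"
proof -
  obtain pr pb py po where "q = (pr, pb, py, po)" by (cases q)
  then have "int (wt4 q) = rank4 q + (int (size pb) + int (size po)) * 5"
    by (simp add: wt4_def rank4_def)
  then show ?thesis by (simp only: mod_mult_self1)
qed

text \<open>This makes the truncation harmless: a part \<open>c * k\<close> is at most the sum, so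
  \<open>k\<close> is at most \<open>N\<close>.\<close>

lemma parts_iff:
  assumes "0 < c" "sum_mset \<pi> \<le> N"
  shows "is_partition \<pi> \<and> parts_dvd c \<pi> \<longleftrightarrow> set_mset \<pi> \<subseteq> (*) c ` {1..N}"
proof
  assume *: "is_partition \<pi> \<and> parts_dvd c \<pi>"
  show "set_mset \<pi> \<subseteq> (*) c ` {1..N}"
  proof
    fix x assume x: "x \<in># \<pi>"
    then obtain k where k: "x = c * k" "0 < x"
      using * unfolding is_partition_def parts_dvd_def by (metis dvdE)
    have "x \<le> sum_mset \<pi>" using x by (auto dest!: multi_member_split)
    moreover have "k \<le> x" using k assms(1) by simp
    ultimately have "k \<le> N" using assms(2) by linarith
    moreover have "1 \<le> k" using k by (cases k) auto
    ultimately have "k \<in> {1..N}" by simp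
    then show "x \<in> (*) c ` {1..N}" using k by blast
  qed
next
  assume sub: "set_mset \<pi> \<subseteq> (*) c ` {1..N}"
  have "0 < x \<and> c dvd x" if "x \<in># \<pi>" for x
    using subsetD[OF sub that] assms(1) by auto
  then show "is_partition \<pi> \<and> parts_dvd c \<pi>"
    by (simp add: is_partition_def parts_dvd_def)
qed

text \<open>The nested \<open>case\<close> form is the one that iterated \<open>gf_mult\<close>
  produces.\<close>

lemma four_col_parts_eq:
  fixes c d N :: nat
  assumes "0 < c" "0 < d"
  defines "A \<equiv> {\<pi>. set_mset \<pi> \<subseteq> (*) c ` {1..N}}" and "B \<equiv> {\<pi>. set_mset \<pi> \<subseteq> (*) d ` {1..N}}"
  shows "four_col_parts c d N = {x \<in> A \<times> A \<times> B \<times> B.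
    (case x of (pr, y) \<Rightarrow> sum_mset pr + (case y of (pb, u) \<Rightarrow> sum_mset pb +
      (case u of (py, po) \<Rightarrow> sum_mset py + sum_mset po))) = N}"
proof -
  have "q \<in> four_col_parts c d N \<longleftrightarrow> q \<in> {x \<in> A \<times> A \<times> B \<times> B.
    (case x of (pr, y) \<Rightarrow> sum_mset pr + (case y of (pb, u) \<Rightarrow> sum_mset pb +
      (case u of (py, po) \<Rightarrow> sum_mset py + sum_mset po))) = N}" for q
  proof -
    obtain pr pb py po where q: "q = (pr, pb, py, po)" by (cases q)
    show ?thesis
    proof (cases "sum_mset pr + sum_mset pb + sum_mset py + sum_mset po = N")
      case True
      then have "sum_mset pr \<le> N" "sum_mset pb \<le> N" "sum_mset py \<le> N" "sum_mset po \<le> N"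
        by auto
      note iffs = parts_iff[OF assms(1) this(1)] parts_iff[OF assms(1) this(2)]
        parts_iff[OF assms(2) this(3)] parts_iff[OF assms(2) this(4)]
      have "q \<in> four_col_parts c d N \<longleftrightarrow> (is_partition pr \<and> parts_dvd c pr) \<and>
          (is_partition pb \<and> parts_dvd c pb) \<and> (is_partition py \<and> parts_dvd d py) \<and>
          (is_partition po \<and> parts_dvd d po)"
        using True by (simp add: q four_col_parts_def) blast
      then show ?thesis
        unfolding iffs using True by (simp add: q A_def B_def add.assoc)
    qed (auto simp: q four_col_parts_def)
  qed
  then show ?thesis by blast
qed

text \<open>\<open>z ^ wt4\<close> factors over the colors, with weight \<open>z\<close> per red or
  yellow part and \<open>z ^ 4\<close> per blue or orange part, so \<open>gf_mult\<close> applies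
  three times.\<close>

lemma
  fixes z :: "'a::comm_ring_1" and c d N :: nat
  assumes c: "0 < c" and d: "0 < d"
  defines "S \<equiv> (*) c ` {1..N}" and "T \<equiv> (*) d ` {1..N}"
  shows finite_four_col_parts: "finite (four_col_parts c d N)"
    and sum_four_col_parts: "(\<Sum>q\<in>four_col_parts c d N. z ^ wt4 q) =
      (mset_gf z S * (mset_gf (z ^ 4) S * (mset_gf z T * mset_gf (z ^ 4) T))) $ N"
proof -
  have fin: "finite {\<pi> \<in> {\<pi>. set_mset \<pi> \<subseteq> (*) e ` {1..N}}. sum_mset \<pi> = n}" if "0 < e" for e n
  proof -
    have "0 \<notin> (*) e ` {1..N}" using that by auto
    then show ?thesis using finite_msets[of "(*) e ` {1..N}" n] by (simp add: msets_def)
  qed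
  note f1 = fin[OF c, folded S_def] and f2 = fin[OF d, folded T_def]
  note f3 = finite_fibre_Times[OF f2 f2]
  note f4 = finite_fibre_Times[OF f1 f3]
  show "finite (four_col_parts c d N)"
    unfolding four_col_parts_eq[OF c d] using finite_fibre_Times[OF f1 f4] by (simp add: S_def T_def)
  have w: "z ^ wt4 q = (case q of (pr, y) \<Rightarrow> z ^ size pr * (case y of (pb, u) \<Rightarrow>
      (z ^ 4) ^ size pb * (case u of (py, po) \<Rightarrow> z ^ size py * (z ^ 4) ^ size po)))" for q
    by (simp add: wt4_def power_add power_mult split: prod.split)
  show "(\<Sum>q\<in>four_col_parts c d N. z ^ wt4 q) =
      (mset_gf z S * (mset_gf (z ^ 4) S * (mset_gf z T * mset_gf (z ^ 4) T))) $ N"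
    unfolding mset_gf_def gf_mult[OF f2 f2] gf_mult[OF f1 f3] gf_mult[OF f1 f4]
    unfolding gf_def four_col_parts_eq[OF c d] w S_def T_def by simp
qed

text \<open>Discrete Fourier inversion: equidistribution modulo 5 is the vanishing of all nontrivial
  character sums.\<close>

lemma card_residue_class_5:
  fixes e :: "'b \<Rightarrow> nat"
  assumes fin: "finite A"
    and vanish: "\<And>\<zeta> :: complex. fifth_root \<zeta> \<Longrightarrow> (\<Sum>x\<in>A. \<zeta> ^ e x) = 0"
  shows "5 * card {x \<in> A. e x mod 5 = k mod 5} = card A"
proof -
  define \<omega> where "\<omega> = cis (2 * pi / 5)"
  have w5: "\<omega> ^ 5 = 1" by (simp add: \<omega>_def DeMoivre)
  have "sin (2 * pi / 5) > 0" by (rule sin_gt_zero) (simp_all add: field_simps)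
  then have w1: "\<omega> \<noteq> 1" by (auto simp: \<omega>_def complex_eq_iff)
  have ne: "\<omega> ^ r \<noteq> 1" if "r \<in> {1, 2, 3, 4}" for r
  proof
    assume "\<omega> ^ r = 1"
    \<comment> \<open>For each \<open>r\<close> from 2 to 4 an exponent \<open>s\<close> with
      \<open>r s\<close> congruent to -1 modulo 5 is chosen, so that \<open>\<omega> ^ r = 1\<close>
      forces \<open>\<omega> = 1\<close>.\<close>
    moreover have "\<omega> * (\<omega> ^ 3) ^ 3 = \<omega> ^ 5 * \<omega> ^ 5" "\<omega> * (\<omega> ^ 2) ^ 2 = \<omega> ^ 5" "\<omega> * \<omega> ^ 4 = \<omega> ^ 5"
      by (simp_all add: power_numeral_reduce mult.assoc)
    ultimately show False using that w5 w1 by (auto simp del: power_mult_numeral)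
  qed
  have root: "fifth_root (\<omega> ^ r)" if "r mod 5 \<noteq> 0" for r
  proof
    have "\<omega> ^ r = \<omega> ^ (5 * (r div 5) + r mod 5)" by simp
    also have "\<dots> = \<omega> ^ (r mod 5)" unfolding power_add power_mult w5 by simp
    finally have "\<omega> ^ r = \<omega> ^ (r mod 5)" .
    moreover have "r mod 5 \<in> {1, 2, 3, 4}"
      using that by (simp, linarith)
    ultimately have "\<omega> ^ r \<noteq> 1" using ne by metis
    moreover have "(\<omega> ^ r) ^ 5 = 1" by (metis mult.commute power_mult power_one w5)
    moreover have "(\<omega> ^ r - 1) * (1 + \<omega> ^ r + (\<omega> ^ r) ^ 2 + (\<omega> ^ r) ^ 3 + (\<omega> ^ r) ^ 4) = (\<omega> ^ r) ^ 5 - 1"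
      by (simp add: algebra_simps power_numeral_reduce)
    ultimately show "1 + \<omega> ^ r + (\<omega> ^ r) ^ 2 + (\<omega> ^ r) ^ 3 + (\<omega> ^ r) ^ 4 = 0" by auto
  qed
  \<comment> \<open>As 4 is -1 modulo 5, \<open>4 * k\<close> stands for \<open>-k\<close> while
    exponents remain natural numbers.\<close>
  have inner: "(\<Sum>s<5. (\<omega> ^ s) ^ (e x + 4 * k)) = (if e x mod 5 = k mod 5 then 5 else 0)" for x
  proof -
    let ?m = "e x + 4 * k"
    have geom: "(\<Sum>s<5. y ^ s) = 1 + y + y ^ 2 + y ^ 3 + y ^ 4" for y :: complex
      by (simp add: eval_nat_numeral)
    have "(\<Sum>s<5. (\<omega> ^ s) ^ ?m) = (\<Sum>s<5. (\<omega> ^ ?m) ^ s)"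
      by (intro sum.cong refl) (metis mult.commute power_mult)
    then have "(\<Sum>s<5. (\<omega> ^ s) ^ ?m) = 1 + \<omega> ^ ?m + (\<omega> ^ ?m) ^ 2 + (\<omega> ^ ?m) ^ 3 + (\<omega> ^ ?m) ^ 4"
      unfolding geom .
    moreover have "e x mod 5 = k mod 5 \<longleftrightarrow> ?m mod 5 = 0" by presburger
    moreover have "\<omega> ^ ?m = 1" if "?m mod 5 = 0"
      using that w5 by (metis mod_0_imp_dvd dvdE power_mult power_one)
    ultimately show ?thesis
      using fifth_root.cyclotomic[OF root[of ?m]] by auto
  qed
  have "of_nat (5 * card {x \<in> A. e x mod 5 = k mod 5}) =
      (\<Sum>x\<in>A. if e x mod 5 = k mod 5 then 5 else (0 :: complex))"
    using fin by (simp add: sum.If_cases Int_def)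
  also have "\<dots> = (\<Sum>s<5. \<Sum>x\<in>A. (\<omega> ^ s) ^ (e x + 4 * k))"
    unfolding inner[symmetric] by (rule sum.swap)
  also have "\<dots> = (\<Sum>s<5. (\<Sum>x\<in>A. (\<omega> ^ s) ^ e x) * (\<omega> ^ s) ^ (4 * k))"
    by (simp only: power_add sum_distrib_right)
  also have "\<dots> = (\<Sum>s<5::nat. if s = 0 then of_nat (card A) else 0)"
    by (rule sum.cong) (auto simp: vanish[OF root])
  finally have "of_nat (5 * card {x \<in> A. e x mod 5 = k mod 5}) = (of_nat (card A) :: complex)"
    by simp
  then show ?thesis unfolding of_nat_eq_iff .
qed

text \<open>A finite check over the pairs \<open>(i, j)\<close>; the four excluded residues are
  those that the exponents of the product of two pairs can take.\<close>

lemma a_vals_avoids: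
  assumes "i \<le> 4" "j \<le> 4" "a \<in> a_vals i j"
  shows "a mod 5 \<noteq> 0 \<and> a mod 5 \<noteq> i \<and> a mod 5 \<noteq> j \<and> a mod 5 \<noteq> (i + j) mod 5"
proof -
  have "i \<in> {0, 1, 2, 3, 4}" "j \<in> {0, 1, 2, 3, 4}" using assms by auto
  then show ?thesis
    using assms(3) by (elim insertE emptyE; force simp: a_vals_def a_tab_def)
qed

theorem theorem3p3:
  fixes c d i j a n :: nat and k :: int
  assumes "1 \<le> c" and "c \<le> d"
    and "i \<le> 4" and "j \<le> 4"
    and "c mod 5 = i" and "d mod 5 = j"
    and "a \<in> a_vals i j"
    and "0 \<le> k" and "k \<le> 4"
  shows "real (N4 c d k 5 (5 * n + a)) = real (p4 c d (5 * n + a)) / 5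
         \<and> p4 c d (5 * n + a) mod 5 = 0"
proof -
  have c: "0 < c" and d: "0 < d" using assms by auto
  \<comment> \<open>\<open>N\<close> is both the number partitioned and the truncation bound, so the
    coefficient in question lies in the range controlled by \<open>supp5\<close>.\<close>
  define N where "N = 5 * n + a"
  have "5 * card {q \<in> four_col_parts c d N. wt4 q mod 5 = nat k mod 5} = card (four_col_parts c d N)"
  proof (rule card_residue_class_5)
    fix \<zeta> :: complex assume "fifth_root \<zeta>"
    then interpret fifth_root \<zeta> .
    let ?S = "(*) c ` {1..N}" and ?T = "(*) d ` {1..N}"
    have "N mod 5 \<noteq> (r + t) mod 5" if "r \<in> {0, i}" "t \<in> {0, j}" for r t
      using that assms(3,4) a_vals_avoids[OF assms(3,4,7)] by (elim insertE emptyE) (simp_all add: N_def)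
    then have "N mod 5 \<notin> {(r + t) mod 5 | r t. r \<in> {0, c mod 5} \<and> t \<in> {0, d mod 5}}"
      unfolding assms(5,6) by blast
    then have "((mset_gf \<zeta> ?S * mset_gf (\<zeta> ^ 4) ?S) * (mset_gf \<zeta> ?T * mset_gf (\<zeta> ^ 4) ?T)) $ N = 0"
      using supp5_mult[OF supp5_pair[OF c, of N] supp5_pair[OF d, of N]] unfolding supp5_def by blast
    then show "(\<Sum>q\<in>four_col_parts c d N. \<zeta> ^ wt4 q) = 0"
      unfolding sum_four_col_parts[OF c d] by (simp only: mult.assoc)
  qed (rule finite_four_col_parts[OF c d])
  moreover have "rank4 q mod int 5 = k mod int 5 \<longleftrightarrow> wt4 q mod 5 = nat k mod 5" for q
  proof -
    have "k = int (nat k)" using assms by simp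
    then show ?thesis
      using rank4_mod_5[of q] by (metis of_nat_eq_iff of_nat_numeral zmod_int)
  qed
  ultimately have "5 * N4 c d k 5 N = p4 c d N"
    unfolding N4_def p4_def by simp
  then show ?thesis unfolding N_def[symmetric]
    by (metis mod_mult_self1_is_0 nonzero_mult_div_cancel_left of_nat_mult of_nat_numeral zero_neq_numeral)
qed

end
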